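(* Let $\mathbb{F}$ be an arbitrary field and let $P(\lambda)=\sum_{k=0}^dP_k\lambda^k\in\mathbb{F}[\lambda]^{n\times n}$ be a symmetric matrix polynomial ($P_k^T=P_k$ for all $k$) of odd degree $d$. Let $s=(d-1)/2$, let $\lambda B+A\in\mathbb{F}[\lambda]^{(s+1)n\times(s+1)n}$ be a pencil, and partition $A$ and $B$ into $n\times n$ blocks $A_{ij},B_{ij}$, $i,j=1,\dots,s+1$. Consider the system of equations $$\sum_{i+j=d+2-k}B_{ij}+\sum_{i+j=d+1-k}A_{ij}=P_k,\qquad k=0,1,\dots,d.\qquad( * )$$ Then the general symmetric pencil solution $\lambda B+A$ (i.e. with $A^T=A$, $B^T=B$) of $( * )$ is obtained by letting the entries of the upper off-diagonal blocks $A_{ij},B_{ij}$, $i<j$, be free parameters, setting $A_{ji}=A_{ij}^T$ and $B_{ji}=B_{ij}^T$ for $i<j$, and setting, for $k=1,2,\dots,s+1$, $$B_{kk}=P_{d-2k+2}-\sum_{\substack{i+j=2k\\ i<j}}(B_{ij}+B_{ij}^T)-\sum_{\substack{i+j=2k-1\\ i<j}}(A_{ij}+A_{ij}^T),$$ $$A_{kk}=P_{d-2k+1}-\sum_{\substack{i+j=2k+1\\ i<j}}(B_{ij}+B_{ij}^T)-\sum_{\substack{i+j=2k\\ i<j}}(A_{ij}+A_{ij}^T).$$ That is, the symmetric pencils satisfying $( * )$ are exactly the pencils of this form, for arbitrary choices of the blocks $A_{ij},B_{ij}\in\mathbb{F}^{n\times n}$ with $i<j$.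
   Context: All sums are over block indices $1\le i,j\le s+1$; empty sums are zero. *)

theory Defs
  imports "Jordan_Normal_Form.Matrix" "HOL-Computational_Algebra.Polynomial"
begin

definition coeff_mat :: "'a::zero poly mat \<Rightarrow> nat \<Rightarrow> 'a mat" where
  "coeff_mat P k = map_mat (\<lambda>p. coeff p k) P"

(* The degree of a matrix polynomial is the largest degree of its entries; as for scalar
   polynomials in the library, the zero matrix polynomial gets degree 0. *)
definition degree_mat :: "'a::zero poly mat \<Rightarrow> nat" where
  "degree_mat P = Max (insert 0 (degree ` elements_mat P))"

definition pencil :: "'a::field mat \<Rightarrow> 'a mat \<Rightarrow> 'a poly mat" where
  "pencil A B = monom 1 1 \<cdot>\<^sub>m map_mat (\<lambda>b. [:b:]) B + map_mat (\<lambda>a. [:a:]) A"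

(* Block indices start at 1, whereas the entry indices of the matrix type start at 0. *)
definition block :: "nat \<Rightarrow> 'a mat \<Rightarrow> nat \<Rightarrow> nat \<Rightarrow> 'a mat" where
  "block n M i j = mat n n (\<lambda>(p, q). M $$ ((i - 1) * n + p, (j - 1) * n + q))"

definition from_blocks :: "nat \<Rightarrow> nat \<Rightarrow> (nat \<Rightarrow> nat \<Rightarrow> 'a mat) \<Rightarrow> 'a mat" where
  "from_blocks n m F =
     mat (m * n) (m * n) (\<lambda>(p, q). F (p div n + 1) (q div n + 1) $$ (p mod n, q mod n))"

lemma block_from_blocks:
  assumes "i \<in> {1..m}" "j \<in> {1..m}" "F i j \<in> carrier_mat n n"
  shows "block n (from_blocks n m F) i j = F i j"
proof (rule eq_matI)
  have bound: "(k - 1) * n + p < m * n" if "k \<in> {1..m}" "p < n" for k p :: nat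
  proof -
    have "(k - 1) * n + p < (k - 1) * n + n" using that by simp
    also have "\<dots> = k * n" using that by (cases k) auto
    also have "\<dots> \<le> m * n" using that by simp
    finally show ?thesis .
  qed
  fix p q assume "p < dim_row (F i j)" "q < dim_col (F i j)"
  then have "p < n" "q < n" using assms by auto
  then show "block n (from_blocks n m F) i j $$ (p, q) = F i j $$ (p, q)"
    using bound[of i p] bound[of j q] assms by (simp add: block_def from_blocks_def)
qed (use assms in \<open>auto simp: block_def\<close>)

(* The matrix type has no zero valid for all dimensions and hence no sum operator of its own;
   this is the library's sum over an abelian monoid, taken in the n-by-n matrices. *)
abbreviation mat_sum :: "nat \<Rightarrow> ('b \<Rightarrow> 'a::semiring_1 mat) \<Rightarrow> 'b set \<Rightarrow> 'a mat" where
  "mat_sum n f S \<equiv> finsum (module_mat TYPE('a) n n) f S"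

definition antidiag :: "nat \<Rightarrow> nat \<Rightarrow> (nat \<times> nat) set" where
  "antidiag m t = {(i, j). i \<in> {1..m} \<and> j \<in> {1..m} \<and> i + j = t}"

definition upper_antidiag :: "nat \<Rightarrow> nat \<Rightarrow> (nat \<times> nat) set" where
  "upper_antidiag m t = {(i, j). (i, j) \<in> antidiag m t \<and> i < j}"

definition satisfies_system ::
  "nat \<Rightarrow> nat \<Rightarrow> nat \<Rightarrow> 'a::field poly mat \<Rightarrow> 'a mat \<Rightarrow> 'a mat \<Rightarrow> bool" where
  "satisfies_system n d s P A B \<longleftrightarrow>
     (\<forall>k\<in>{0..d}.
        mat_sum n (\<lambda>(i, j). block n B i j) (antidiag (s + 1) (d + 2 - k))
        + mat_sum n (\<lambda>(i, j). block n A i j) (antidiag (s + 1) (d + 1 - k))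
        = coeff_mat P k)"

(* X and Y hold the free upper off-diagonal blocks of A and B; only the values X i j and
   Y i j with i < j are used. In the coefficient indices the natural number subtractions are
   exact for d = 2 s + 1 and i \<le> s + 1. *)
definition sol_A :: "nat \<Rightarrow> nat \<Rightarrow> nat \<Rightarrow> 'a::field poly mat \<Rightarrow>
    (nat \<Rightarrow> nat \<Rightarrow> 'a mat) \<Rightarrow> (nat \<Rightarrow> nat \<Rightarrow> 'a mat) \<Rightarrow> nat \<Rightarrow> nat \<Rightarrow> 'a mat" where
  "sol_A n d s P X Y i j =
     (if i < j then X i j
      else if j < i then transpose_mat (X j i)
      else coeff_mat P (d + 1 - 2 * i)
        - mat_sum n (\<lambda>(p, q). Y p q + transpose_mat (Y p q)) (upper_antidiag (s + 1) (2 * i + 1))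
        - mat_sum n (\<lambda>(p, q). X p q + transpose_mat (X p q)) (upper_antidiag (s + 1) (2 * i)))"

definition sol_B :: "nat \<Rightarrow> nat \<Rightarrow> nat \<Rightarrow> 'a::field poly mat \<Rightarrow>
    (nat \<Rightarrow> nat \<Rightarrow> 'a mat) \<Rightarrow> (nat \<Rightarrow> nat \<Rightarrow> 'a mat) \<Rightarrow> nat \<Rightarrow> nat \<Rightarrow> 'a mat" where
  "sol_B n d s P X Y i j =
     (if i < j then Y i j
      else if j < i then transpose_mat (Y j i)
      else coeff_mat P (d + 2 - 2 * i)
        - mat_sum n (\<lambda>(p, q). Y p q + transpose_mat (Y p q)) (upper_antidiag (s + 1) (2 * i))
        - mat_sum n (\<lambda>(p, q). X p q + transpose_mat (X p q)) (upper_antidiag (s + 1) (2 * i - 1)))"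

end

(* An antidiagonal sum of a block-symmetric matrix pairs (i, j) with (j, i): it is the sum of
   F i j + (F i j)^T over i < j, plus the block F k k when the index sum is 2 k. Each index sum
   t = d + 1 - k with k = 0, ..., d thus makes exactly one diagonal block appear in the k-th
   equation, namely one of A if t is even and one of B if t is odd, and that equation can be
   solved for it. *)
theory Submission
  imports Defs
begin

section \<open>Antidiagonal index sets and sums of n-by-n matrices\<close>

lemma finite_antidiag [simp]: "finite (antidiag m t)"
  by (rule finite_subset[of _ "{1..m} \<times> {1..m}"]) (auto simp: antidiag_def)

lemma finite_upper_antidiag [simp]: "finite (upper_antidiag m t)"
  by (rule finite_subset[OF _ finite_antidiag[of m t]]) (auto simp: upper_antidiag_def)

lemma upper_antidiagD:
  assumes "(i, j) \<in> upper_antidiag m t"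
  shows "i \<in> {1..m}" "j \<in> {1..m}" "i < j" "i + j = t"
  using assms by (auto simp: upper_antidiag_def antidiag_def)

lemma mat_sum_carrier:
  fixes f :: "'b \<Rightarrow> 'a :: comm_ring_1 mat"
  assumes "\<And>x. x \<in> S \<Longrightarrow> f x \<in> carrier_mat n n"
  shows "mat_sum n f S \<in> carrier_mat n n"
proof -
  interpret abelian_group "module_mat TYPE('a) n n" by (rule abelian_group_mat)
  show ?thesis
    using finsum_closed[of f S] assms by (auto simp: module_mat_simps)
qed

text \<open>Identities between matrix sums are thereby reduced to sums in the ring, where splitting
  and reindexing of index sets are available.\<close>

lemma index_mat_sum:
  fixes f :: "'b \<Rightarrow> 'a :: comm_ring_1 mat"
  assumes "finite S" "\<And>x. x \<in> S \<Longrightarrow> f x \<in> carrier_mat n n" "p < n" "q < n"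
  shows "mat_sum n f S $$ (p, q) = (\<Sum>x\<in>S. f x $$ (p, q))"
  using assms(1,2)
proof (induction S)
  interpret abelian_group "module_mat TYPE('a) n n" by (rule abelian_group_mat)
  case empty
  then show ?case using assms(3,4) by (simp add: module_mat_simps)
next
  interpret abelian_group "module_mat TYPE('a) n n" by (rule abelian_group_mat)
  case (insert x S)
  have "mat_sum n f (insert x S) = f x + mat_sum n f S"
    using insert finsum_insert[of S x f] by (auto simp: module_mat_simps)
  moreover have "mat_sum n f S \<in> carrier_mat n n"
    using insert.prems by (intro mat_sum_carrier) auto
  ultimately show ?case using insert assms(3,4) by simp
qed

lemma mat_sum_cong:
  fixes f g :: "'b \<Rightarrow> 'a :: comm_ring_1 mat"
  assumes "finite S" "\<And>x. x \<in> S \<Longrightarrow> f x = g x" "\<And>x. x \<in> S \<Longrightarrow> g x \<in> carrier_mat n n"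
  shows "mat_sum n f S = mat_sum n g S"
proof -
  interpret abelian_group "module_mat TYPE('a) n n" by (rule abelian_group_mat)
  show ?thesis using assms by (intro finsum_cong') (auto simp: module_mat_simps)
qed

text \<open>Swapping (i, j) and (j, i) is an involution of the antidiagonal. Its only possible fixed
  point is (t/2, t/2), and the pairs with i < j represent the remaining orbits, each once.\<close>

lemma sum_antidiag:
  fixes g :: "nat \<times> nat \<Rightarrow> 'a :: comm_monoid_add"
  shows "sum g (antidiag m t) =
    (if even t \<and> t div 2 \<in> {1..m} then g (t div 2, t div 2) else 0)
      + (\<Sum>(i, j)\<in>upper_antidiag m t. g (i, j) + g (j, i))"
proof -
  \<comment> \<open>The fixed points of the swap, at most one. Parity alone does not decide: an even
    t outside 2, ..., 2 m has none, hence the range condition on \<open>t div 2\<close>.\<close>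
  define D where "D = (if even t \<and> t div 2 \<in> {1..m} then {(t div 2, t div 2)} else {})"
  let ?U = "upper_antidiag m t"
  have split: "antidiag m t = D \<union> (?U \<union> prod.swap ` ?U)"
  proof (intro Set.set_eqI)
    fix x :: "nat \<times> nat"
    obtain i j where x: "x = (i, j)" by fastforce
    have "x \<in> prod.swap ` ?U \<longleftrightarrow> (j, i) \<in> ?U" by (force simp: x)
    moreover have "x \<in> D \<longleftrightarrow> i = j \<and> i \<in> {1..m} \<and> i + j = t"
      by (auto simp: x D_def)
    ultimately show "x \<in> antidiag m t \<longleftrightarrow> x \<in> D \<union> (?U \<union> prod.swap ` ?U)"
      by (auto simp: x upper_antidiag_def antidiag_def)
  qed
  have "sum g (antidiag m t) = sum g D + (sum g ?U + sum g (prod.swap ` ?U))"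
  proof -
    have "D \<inter> (?U \<union> prod.swap ` ?U) = {}" "?U \<inter> prod.swap ` ?U = {}"
      by (auto simp: D_def upper_antidiag_def)
    then show ?thesis
      unfolding split by (simp add: sum.union_disjoint D_def)
  qed
  also have "sum g (prod.swap ` ?U) = (\<Sum>(i, j)\<in>?U. g (j, i))"
    by (subst sum.reindex) (auto intro!: sum.cong)
  also have "sum g ?U = (\<Sum>(i, j)\<in>?U. g (i, j))"
    by (intro sum.cong) auto
  also have "sum g D = (if even t \<and> t div 2 \<in> {1..m} then g (t div 2, t div 2) else 0)"
    by (simp add: D_def)
  finally show ?thesis
    by (simp add: sum.distrib[symmetric] case_prod_unfold)
qed

section \<open>Symmetrised sums over the blocks above the diagonal\<close>

definition offdiag_sum :: "nat \<Rightarrow> nat \<Rightarrow> (nat \<Rightarrow> nat \<Rightarrow> 'a::comm_ring_1 mat) \<Rightarrow> nat \<Rightarrow> 'a mat" where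
  "offdiag_sum n m F t =
     mat_sum n (\<lambda>(p, q). F p q + transpose_mat (F p q)) (upper_antidiag m t)"

text \<open>This is the condition that the theorem puts on its parameters. Values on and below the
  diagonal stay arbitrary, since they never enter an upper antidiagonal.\<close>

definition upper_blocks :: "nat \<Rightarrow> nat \<Rightarrow> (nat \<Rightarrow> nat \<Rightarrow> 'a mat) \<Rightarrow> bool" where
  "upper_blocks n m F \<longleftrightarrow> (\<forall>i j. 1 \<le> i \<and> i < j \<and> j \<le> m \<longrightarrow> F i j \<in> carrier_mat n n)"

lemma upper_blocks_antidiag:
  assumes "upper_blocks n m F" "(i, j) \<in> upper_antidiag m t"
  shows "F i j \<in> carrier_mat n n"
  using assms(1) upper_antidiagD[OF assms(2)] by (auto simp: upper_blocks_def)

lemma offdiag_sum_carrier: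
  assumes "upper_blocks n m F"
  shows "offdiag_sum n m F t \<in> carrier_mat n n"
  unfolding offdiag_sum_def
  by (intro mat_sum_carrier) (auto dest: upper_blocks_antidiag[OF assms])

lemma index_offdiag_sum:
  assumes "upper_blocks n m F" "p < n" "q < n"
  shows "offdiag_sum n m F t $$ (p, q) =
    (\<Sum>(i, j)\<in>upper_antidiag m t. F i j $$ (p, q) + F i j $$ (q, p))"
proof -
  have "offdiag_sum n m F t $$ (p, q) =
      (\<Sum>x\<in>upper_antidiag m t.
        (case x of (i, j) \<Rightarrow> F i j + transpose_mat (F i j)) $$ (p, q))"
    unfolding offdiag_sum_def using assms(2,3)
    by (intro index_mat_sum) (auto dest: upper_blocks_antidiag[OF assms(1)])
  also have "\<dots> = (\<Sum>(i, j)\<in>upper_antidiag m t. F i j $$ (p, q) + F i j $$ (q, p))"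
    using assms(2,3) by (intro sum.cong) (auto dest: upper_blocks_antidiag[OF assms(1)])
  finally show ?thesis .
qed

text \<open>Each summand is a matrix plus its transpose; entrywise the claim is commutativity of
  addition. The corrections subtracted in the diagonal blocks are therefore symmetric.\<close>

lemma transpose_offdiag_sum:
  assumes "upper_blocks n m F"
  shows "transpose_mat (offdiag_sum n m F t) = offdiag_sum n m F t"
  using offdiag_sum_carrier[OF assms, of t]
  by (intro eq_matI) (auto simp: index_offdiag_sum[OF assms] add.commute)

text \<open>Only values above the diagonal enter, so the free parameters can be exchanged for the
  blocks of the matrix assembled from them.\<close>

lemma offdiag_sum_cong:
  assumes "\<And>i j. 1 \<le> i \<Longrightarrow> i < j \<Longrightarrow> j \<le> m \<Longrightarrow> F i j = G i j" "upper_blocks n m G"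
  shows "offdiag_sum n m F t = offdiag_sum n m G t"
proof -
  have "F i j = G i j" if "(i, j) \<in> upper_antidiag m t" for i j
    using upper_antidiagD[OF that] by (intro assms(1)) auto
  then show ?thesis
    unfolding offdiag_sum_def
    by (intro mat_sum_cong) (auto dest: upper_blocks_antidiag[OF assms(2)])
qed

text \<open>The terms at (i, j) and (j, i) in \<open>sum_antidiag\<close> combine to a block plus
  its transpose, because of \<open>sym\<close>. The proof compares entries, as
  \<open>sum_antidiag\<close> is a statement about \<open>sum\<close>.\<close>

lemma mat_sum_antidiag_symmetric:
  fixes F :: "nat \<Rightarrow> nat \<Rightarrow> 'a :: comm_ring_1 mat"
  assumes carrier: "\<And>i j. i \<in> {1..m} \<Longrightarrow> j \<in> {1..m} \<Longrightarrow> F i j \<in> carrier_mat n n"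
    and sym: "\<And>i j. i \<in> {1..m} \<Longrightarrow> j \<in> {1..m} \<Longrightarrow> F j i = transpose_mat (F i j)"
  shows "mat_sum n (\<lambda>(i, j). F i j) (antidiag m t) =
    (if even t \<and> t div 2 \<in> {1..m} then F (t div 2) (t div 2) else 0\<^sub>m n n)
      + offdiag_sum n m F t" (is "?L = ?D + ?O")
proof (rule eq_matI)
  have ub: "upper_blocks n m F" using carrier by (auto simp: upper_blocks_def)
  have L: "?L \<in> carrier_mat n n"
    by (intro mat_sum_carrier) (auto simp: antidiag_def intro!: carrier)
  have O: "?O \<in> carrier_mat n n" by (rule offdiag_sum_carrier[OF ub])
  show "dim_row ?L = dim_row (?D + ?O)" "dim_col ?L = dim_col (?D + ?O)"
    using L O by auto
  fix p q assume "p < dim_row (?D + ?O)" "q < dim_col (?D + ?O)"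
  then have pq: "p < n" "q < n" using O by auto
  have "?L $$ (p, q) = (\<Sum>x\<in>antidiag m t. (case x of (i, j) \<Rightarrow> F i j) $$ (p, q))"
    using pq by (intro index_mat_sum finite_antidiag) (auto simp: antidiag_def intro!: carrier)
  also have "\<dots> = (if even t \<and> t div 2 \<in> {1..m} then F (t div 2) (t div 2) $$ (p, q) else 0)
      + (\<Sum>(i, j)\<in>upper_antidiag m t. F i j $$ (p, q) + F j i $$ (p, q))"
    unfolding sum_antidiag by (simp only: prod.case)
  also have "(\<Sum>(i, j)\<in>upper_antidiag m t. F i j $$ (p, q) + F j i $$ (p, q)) = ?O $$ (p, q)"
    unfolding index_offdiag_sum[OF ub pq]
  proof (intro sum.cong refl, clarify)
    fix i j assume "(i, j) \<in> upper_antidiag m t"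
    note ij = upper_antidiagD(1,2)[OF this]
    show "F i j $$ (p, q) + F j i $$ (p, q) = F i j $$ (p, q) + F i j $$ (q, p)"
      using pq carrier[OF ij] by (simp add: sym[OF ij])
  qed
  finally show "?L $$ (p, q) = (?D + ?O) $$ (p, q)"
    using pq O by auto
qed

lemma sol_A_diag:
  "sol_A n d s P X Y i i = coeff_mat P (d + 1 - 2 * i)
     - offdiag_sum n (s + 1) Y (2 * i + 1) - offdiag_sum n (s + 1) X (2 * i)"
  by (simp add: sol_A_def offdiag_sum_def)

lemma sol_B_diag:
  "sol_B n d s P X Y i i = coeff_mat P (d + 2 - 2 * i)
     - offdiag_sum n (s + 1) Y (2 * i) - offdiag_sum n (s + 1) X (2 * i - 1)"
  by (simp add: sol_B_def offdiag_sum_def)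

section \<open>Cutting a matrix into blocks and assembling it again\<close>

lemma block_index_bound:
  fixes i n m p :: nat
  assumes "i \<in> {1..m}" "p < n"
  shows "(i - 1) * n + p < m * n"
proof -
  have "(i - 1) * n + p < (i - 1) * n + n" using assms by simp
  also have "\<dots> = i * n" using assms by (cases i) auto
  also have "\<dots> \<le> m * n" using assms by simp
  finally show ?thesis .
qed

lemma block_carrier [simp]: "block n M i j \<in> carrier_mat n n"
  by (simp add: block_def)

lemma from_blocks_carrier [simp]: "from_blocks n m F \<in> carrier_mat (m * n) (m * n)"
  by (simp add: from_blocks_def)

text \<open>Transposition exchanges the block offsets and the positions inside the block at the same
  time.\<close>

lemma block_symmetric:
  assumes "M \<in> carrier_mat (m * n) (m * n)" "transpose_mat M = M" "i \<in> {1..m}" "j \<in> {1..m}"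
  shows "block n M j i = transpose_mat (block n M i j)"
proof (rule eq_matI)
  fix p q assume "p < dim_row (transpose_mat (block n M i j))"
    "q < dim_col (transpose_mat (block n M i j))"
  then have pq: "p < n" "q < n" by (auto simp: block_def)
  have "transpose_mat M $$ ((j - 1) * n + p, (i - 1) * n + q)
      = M $$ ((i - 1) * n + q, (j - 1) * n + p)"
    using assms(1) block_index_bound[OF assms(4) pq(1)] block_index_bound[OF assms(3) pq(2)]
    by simp
  then show "block n M j i $$ (p, q) = transpose_mat (block n M i j) $$ (p, q)"
    using pq by (simp add: block_def assms(2))
qed (auto simp: block_def)

lemma index_from_blocks_bounds:
  fixes p n m :: nat
  assumes "p < m * n"
  shows "p div n + 1 \<in> {1..m}" "p mod n < n"
proof -
  show "p div n + 1 \<in> {1..m}" using assms by (auto simp: less_mult_imp_div_less Suc_le_eq)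
  \<comment> \<open>For n = 0 the hypothesis \<open>p < m * n\<close> is contradictory; otherwise a
    remainder is smaller than the divisor.\<close>
  show "p mod n < n" using assms by (cases n) auto
qed

lemma from_blocks_cong:
  assumes "\<And>i j. i \<in> {1..m} \<Longrightarrow> j \<in> {1..m} \<Longrightarrow> F i j = G i j"
  shows "from_blocks n m F = from_blocks n m G"
proof (rule eq_matI)
  fix p q assume "p < dim_row (from_blocks n m G)" "q < dim_col (from_blocks n m G)"
  then have pq: "p < m * n" "q < m * n" by (auto simp: from_blocks_def)
  then show "from_blocks n m F $$ (p, q) = from_blocks n m G $$ (p, q)"
    using assms[OF index_from_blocks_bounds(1)[OF pq(1)] index_from_blocks_bounds(1)[OF pq(2)]]
    by (simp add: from_blocks_def)
qed (auto simp: from_blocks_def)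

text \<open>Index p lies in block \<open>p div n + 1\<close> at position \<open>p mod n\<close>. The
  shift by one cancels in the offset, and division with remainder restores p.\<close>

lemma from_blocks_block:
  assumes "M \<in> carrier_mat (m * n) (m * n)"
  shows "from_blocks n m (block n M) = M"
  using assms
  by (intro eq_matI) (auto simp: from_blocks_def block_def index_from_blocks_bounds(2))

lemma transpose_from_blocks:
  assumes "\<And>i j. i \<in> {1..m} \<Longrightarrow> j \<in> {1..m} \<Longrightarrow> F i j \<in> carrier_mat n n"
    and "\<And>i j. i \<in> {1..m} \<Longrightarrow> j \<in> {1..m} \<Longrightarrow> F j i = transpose_mat (F i j)"
  shows "transpose_mat (from_blocks n m F) = from_blocks n m F"
proof (rule eq_matI)
  fix p q assume "p < dim_row (from_blocks n m F)" "q < dim_col (from_blocks n m F)"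
  then have pq: "p < m * n" "q < m * n" by (auto simp: from_blocks_def)
  note b = index_from_blocks_bounds[OF pq(1)] index_from_blocks_bounds[OF pq(2)]
  have "F (q div n + 1) (p div n + 1) $$ (q mod n, p mod n)
      = F (p div n + 1) (q div n + 1) $$ (p mod n, q mod n)"
    unfolding assms(2)[OF b(1,3)] using assms(1)[OF b(1,3)] b(2,4) by simp
  then show "transpose_mat (from_blocks n m F) $$ (p, q) = from_blocks n m F $$ (p, q)"
    using pq by (simp add: from_blocks_def)
qed (auto simp: from_blocks_def)

section \<open>Solving each equation for its diagonal block\<close>

lemma add_eq_iff_eq_minus_mat:
  fixes C D U V :: "'a :: ab_group_add mat"
  assumes "C \<in> carrier_mat nr nc" "D \<in> carrier_mat nr nc"
    "U \<in> carrier_mat nr nc" "V \<in> carrier_mat nr nc"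
  shows "U + (D + V) = C \<longleftrightarrow> D = C - U - V" "D + U + V = C \<longleftrightarrow> D = C - U - V"
  using assms by (auto simp: mat_eq_iff algebra_simps)

text \<open>The parameters of \<open>sol_A\<close> and \<open>sol_B\<close> are here the blocks of A
  and B themselves, so the right-hand side expresses the diagonal blocks through the off-diagonal
  ones. A diagonal block occurs with coefficient 1 and is isolated by subtraction alone, hence in
  every characteristic. Both inclusions of the theorem rest on this equivalence.\<close>

lemma satisfies_system_iff:
  fixes A B :: "'a :: field mat"
  assumes P: "P \<in> carrier_mat n n"
    and A: "A \<in> carrier_mat ((s + 1) * n) ((s + 1) * n)" "transpose_mat A = A"
    and B: "B \<in> carrier_mat ((s + 1) * n) ((s + 1) * n)" "transpose_mat B = B"
    and d: "d = 2 * s + 1"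
  shows "satisfies_system n d s P A B \<longleftrightarrow>
    (\<forall>i\<in>{1..s + 1}.
      block n A i i = sol_A n d s P (block n A) (block n B) i i \<and>
      block n B i i = sol_B n d s P (block n A) (block n B) i i)"
proof -
  define E where "E k \<longleftrightarrow>
        mat_sum n (\<lambda>(i, j). block n B i j) (antidiag (s + 1) (d + 2 - k))
        + mat_sum n (\<lambda>(i, j). block n A i j) (antidiag (s + 1) (d + 1 - k))
        = coeff_mat P k" for k
  \<comment> \<open>As d + 1 = 2 (s + 1), the numbers d + 1 - 2 i run through the even k and d + 2 -
    2 i through the odd k of 0, ..., d when i runs from 1 to s + 1.\<close>
  have range: "(\<forall>k\<in>{0..d}. E k) \<longleftrightarrow> (\<forall>i\<in>{1..s + 1}. E (d + 1 - 2 * i) \<and> E (d + 2 - 2 * i))"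
  proof (intro iffI ballI)
    fix k assume R: "\<forall>i\<in>{1..s + 1}. E (d + 1 - 2 * i) \<and> E (d + 2 - 2 * i)" and k: "k \<in> {0..d}"
    show "E k"
    proof (cases "even k")
      case True
      then obtain l where "k = 2 * l" by blast
      \<comment> \<open>Solving 2 l = d + 1 - 2 i gives i = s + 1 - l; the same i solves 2 l + 1 = d
        + 2 - 2 i in the odd case. From k <= d follows l <= s, so i >= 1.\<close>
      then show ?thesis using R[rule_format, of "s + 1 - l"] k d by (auto simp: algebra_simps)
    next
      case False
      then obtain l where "k = 2 * l + 1" by (elim oddE)
      then show ?thesis using R[rule_format, of "s + 1 - l"] k d by (auto simp: algebra_simps)
    qed
  qed (auto simp: d)
  have C: "coeff_mat P k \<in> carrier_mat n n" for k using P by (simp add: coeff_mat_def)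
  have O: "offdiag_sum n (s + 1) (block n M) t \<in> carrier_mat n n" for M :: "'a mat" and t
    by (intro offdiag_sum_carrier) (simp add: upper_blocks_def)
  \<comment> \<open>An odd index sum meets no diagonal block; the zero matrix standing in for it is
    absorbed.\<close>
  have odd_sum: "mat_sum n (\<lambda>(i, j). block n M i j) (antidiag (s + 1) t)
      = offdiag_sum n (s + 1) (block n M) t"
    if "M \<in> carrier_mat ((s + 1) * n) ((s + 1) * n)" "transpose_mat M = M" "odd t"
    for M :: "'a mat" and t
    using mat_sum_antidiag_symmetric[of "s + 1" "block n M" n, OF block_carrier block_symmetric[OF that(1,2)], of t]
      left_add_zero_mat[OF O] that(3) by presburger
  have even_sum: "mat_sum n (\<lambda>(i, j). block n M i j) (antidiag (s + 1) (2 * i))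
      = block n M i i + offdiag_sum n (s + 1) (block n M) (2 * i)"
    if "M \<in> carrier_mat ((s + 1) * n) ((s + 1) * n)" "transpose_mat M = M" "i \<in> {1..s + 1}"
    for M :: "'a mat" and i
    using mat_sum_antidiag_symmetric[of "s + 1" "block n M" n, OF block_carrier block_symmetric[OF that(1,2)], of "2 * i"]
      that(3) by simp
  have "E (d + 1 - 2 * i) \<longleftrightarrow> block n A i i = sol_A n d s P (block n A) (block n B) i i"
    "E (d + 2 - 2 * i) \<longleftrightarrow> block n B i i = sol_B n d s P (block n A) (block n B) i i"
    if i: "i \<in> {1..s + 1}" for i
  proof -
    \<comment> \<open>No subtraction is truncated: i <= s + 1 gives 2 i <= d + 1, and i >= 1 gives d
      + 2 - 2 i <= d. The bound i >= 1 also makes \<open>2 * i - 1\<close> odd below.\<close>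
    have t: "d + 2 - (d + 1 - 2 * i) = 2 * i + 1" "d + 1 - (d + 1 - 2 * i) = 2 * i"
      "d + 2 - (d + 2 - 2 * i) = 2 * i" "d + 1 - (d + 2 - 2 * i) = 2 * i - 1"
      using i d by auto
    have parity: "odd (2 * i + 1)" "odd (2 * i - 1)" using i by auto
    \<comment> \<open>For this even k the blocks of B have the odd index sum 2 i + 1, so the unknown
      is A_ii, inside the second summand. In the other equation it is B_ii, inside the first
      summand; hence the two forms of \<open>add_eq_iff_eq_minus_mat\<close>.\<close>
    show "E (d + 1 - 2 * i) \<longleftrightarrow> block n A i i = sol_A n d s P (block n A) (block n B) i i"
      unfolding E_def t even_sum[OF A i] odd_sum[OF B parity(1)] sol_A_diag
      by (rule add_eq_iff_eq_minus_mat(1)[OF C block_carrier O O])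
    show "E (d + 2 - 2 * i) \<longleftrightarrow> block n B i i = sol_B n d s P (block n A) (block n B) i i"
      unfolding E_def t even_sum[OF B i] odd_sum[OF A parity(2)] sol_B_diag
      by (rule add_eq_iff_eq_minus_mat(2)[OF C block_carrier O O])
  qed
  then show ?thesis
    unfolding satisfies_system_def E_def[symmetric] range by blast
qed

section \<open>Size and symmetry of the blocks given by \<open>sol_A\<close> and
  \<open>sol_B\<close>\<close>

lemma sol_A_carrier:
  assumes "P \<in> carrier_mat n n" "upper_blocks n (s + 1) X" "upper_blocks n (s + 1) Y"
    "i \<in> {1..s + 1}" "j \<in> {1..s + 1}"
  shows "sol_A n d s P X Y i j \<in> carrier_mat n n"
proof (cases "i = j")
  case True
  then show ?thesis
    unfolding True sol_A_diag by (intro minus_carrier_mat offdiag_sum_carrier assms)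
next
  case False
  then show ?thesis using assms(2,4,5) by (auto simp: sol_A_def upper_blocks_def)
qed

lemma sol_B_carrier:
  assumes "P \<in> carrier_mat n n" "upper_blocks n (s + 1) X" "upper_blocks n (s + 1) Y"
    "i \<in> {1..s + 1}" "j \<in> {1..s + 1}"
  shows "sol_B n d s P X Y i j \<in> carrier_mat n n"
proof (cases "i = j")
  case True
  then show ?thesis
    unfolding True sol_B_diag by (intro minus_carrier_mat offdiag_sum_carrier assms)
next
  case False
  then show ?thesis using assms(3,4,5) by (auto simp: sol_B_def upper_blocks_def)
qed

lemma transpose_minus_minus:
  assumes "C \<in> carrier_mat nr nc" "U \<in> carrier_mat nr nc" "V \<in> carrier_mat nr nc"
  shows "transpose_mat (C - U - V) = transpose_mat C - transpose_mat U - transpose_mat V"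
  using assms by (intro eq_matI) auto

text \<open>On the diagonal the symmetry of the coefficients of P enters, together with that of the
  off-diagonal sums. Off the diagonal the blocks are defined in transposed pairs.\<close>

lemma sol_A_symmetric:
  assumes "P \<in> carrier_mat n n" "\<And>k. transpose_mat (coeff_mat P k) = coeff_mat P k"
    "upper_blocks n (s + 1) X" "upper_blocks n (s + 1) Y"
  shows "sol_A n d s P X Y j i = transpose_mat (sol_A n d s P X Y i j)"
proof (cases "i = j")
  case True
  have "coeff_mat P k \<in> carrier_mat n n" for k using assms(1) by (simp add: coeff_mat_def)
  then show ?thesis
    unfolding True sol_A_diag
    by (simp only: transpose_minus_minus[OF _ offdiag_sum_carrier[OF assms(4)]
          offdiag_sum_carrier[OF assms(3)]] assms(2) transpose_offdiag_sum[OF assms(3)]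
        transpose_offdiag_sum[OF assms(4)])
next
  case False
  then show ?thesis by (auto simp: sol_A_def)
qed

lemma sol_B_symmetric:
  assumes "P \<in> carrier_mat n n" "\<And>k. transpose_mat (coeff_mat P k) = coeff_mat P k"
    "upper_blocks n (s + 1) X" "upper_blocks n (s + 1) Y"
  shows "sol_B n d s P X Y j i = transpose_mat (sol_B n d s P X Y i j)"
proof (cases "i = j")
  case True
  have "coeff_mat P k \<in> carrier_mat n n" for k using assms(1) by (simp add: coeff_mat_def)
  then show ?thesis
    unfolding True sol_B_diag
    by (simp only: transpose_minus_minus[OF _ offdiag_sum_carrier[OF assms(4)]
          offdiag_sum_carrier[OF assms(3)]] assms(2) transpose_offdiag_sum[OF assms(3)]
        transpose_offdiag_sum[OF assms(4)])
next
  case False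
  then show ?thesis by (auto simp: sol_B_def)
qed

theorem theorem4p9:
  fixes P :: "'a::field poly mat" and n d s :: nat
  assumes "P \<in> carrier_mat n n"
    and "\<And>k. transpose_mat (coeff_mat P k) = coeff_mat P k"
    and "degree_mat P = d"
    and "odd d"
    and "s = (d - 1) div 2"
  shows "{pencil A B | A B.
            A \<in> carrier_mat ((s + 1) * n) ((s + 1) * n) \<and>
            B \<in> carrier_mat ((s + 1) * n) ((s + 1) * n) \<and>
            transpose_mat A = A \<and> transpose_mat B = B \<and>
            satisfies_system n d s P A B}
       = {pencil (from_blocks n (s + 1) (sol_A n d s P X Y))
                 (from_blocks n (s + 1) (sol_B n d s P X Y)) | X Y.
            \<forall>i j. 1 \<le> i \<and> i < j \<and> j \<le> s + 1 \<longrightarrow>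
              X i j \<in> carrier_mat n n \<and> Y i j \<in> carrier_mat n n}"
proof -
  \<comment> \<open>Oddness of d makes the halving in s exact.\<close>
  have d: "d = 2 * s + 1" using assms(4,5) by (auto elim: oddE)
  show ?thesis
  proof (intro Set.set_eqI iffI)
    fix L :: "'a poly mat"
    assume "L \<in> {pencil A B | A B.
            A \<in> carrier_mat ((s + 1) * n) ((s + 1) * n) \<and>
            B \<in> carrier_mat ((s + 1) * n) ((s + 1) * n) \<and>
            transpose_mat A = A \<and> transpose_mat B = B \<and>
            satisfies_system n d s P A B}"
    then obtain A B where L: "L = pencil A B"
      and A: "A \<in> carrier_mat ((s + 1) * n) ((s + 1) * n)" "transpose_mat A = A"
      and B: "B \<in> carrier_mat ((s + 1) * n) ((s + 1) * n)" "transpose_mat B = B"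
      and sys: "satisfies_system n d s P A B"
      by blast
    note diag = sys[unfolded satisfies_system_iff[OF assms(1) A B d]]
    \<comment> \<open>The parameters recovering A and B are their own blocks. Above the diagonal the
      formula returns them by definition, below by symmetry, and on the diagonal by the
      system.\<close>
    have "sol_A n d s P (block n A) (block n B) i j = block n A i j"
      if "i \<in> {1..s + 1}" "j \<in> {1..s + 1}" for i j
    proof (cases "i = j")
      case True
      then show ?thesis using diag that by simp
    next
      case False
      then show ?thesis using block_symmetric[OF A that(2,1)] by (simp add: sol_A_def)
    qed
    note fA = trans[OF from_blocks_cong[OF this] from_blocks_block[OF A(1)]]
    have "sol_B n d s P (block n A) (block n B) i j = block n B i j"
      if "i \<in> {1..s + 1}" "j \<in> {1..s + 1}" for i j
    proof (cases "i = j")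
      case True
      then show ?thesis using diag that by simp
    next
      case False
      then show ?thesis using block_symmetric[OF B that(2,1)] by (simp add: sol_B_def)
    qed
    note fB = trans[OF from_blocks_cong[OF this] from_blocks_block[OF B(1)]]
    show "L \<in> {pencil (from_blocks n (s + 1) (sol_A n d s P X Y))
                 (from_blocks n (s + 1) (sol_B n d s P X Y)) | X Y.
            \<forall>i j. 1 \<le> i \<and> i < j \<and> j \<le> s + 1 \<longrightarrow>
              X i j \<in> carrier_mat n n \<and> Y i j \<in> carrier_mat n n}"
      unfolding mem_Collect_eq L
      by (rule exI[of _ "block n A"], rule exI[of _ "block n B"]) (simp only: fA fB block_carrier simp_thms)
  next
    fix L :: "'a poly mat"
    assume "L \<in> {pencil (from_blocks n (s + 1) (sol_A n d s P X Y))
                 (from_blocks n (s + 1) (sol_B n d s P X Y)) | X Y.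
            \<forall>i j. 1 \<le> i \<and> i < j \<and> j \<le> s + 1 \<longrightarrow>
              X i j \<in> carrier_mat n n \<and> Y i j \<in> carrier_mat n n}"
    then obtain X Y where
      L: "L = pencil (from_blocks n (s + 1) (sol_A n d s P X Y))
                 (from_blocks n (s + 1) (sol_B n d s P X Y))"
      and X: "upper_blocks n (s + 1) X" and Y: "upper_blocks n (s + 1) Y"
      unfolding upper_blocks_def by blast
    define A where "A = from_blocks n (s + 1) (sol_A n d s P X Y)"
    define B where "B = from_blocks n (s + 1) (sol_B n d s P X Y)"
    have A: "A \<in> carrier_mat ((s + 1) * n) ((s + 1) * n)" "transpose_mat A = A"
      unfolding A_def using assms(1,2) X Y
      by (auto intro!: transpose_from_blocks sol_A_carrier sol_A_symmetric
          simp del: One_nat_def add_Suc_right Nat.add_0_right mult_Suc)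
    have B: "B \<in> carrier_mat ((s + 1) * n) ((s + 1) * n)" "transpose_mat B = B"
      unfolding B_def using assms(1,2) X Y
      by (auto intro!: transpose_from_blocks sol_B_carrier sol_B_symmetric
          simp del: One_nat_def add_Suc_right Nat.add_0_right mult_Suc)
    have bA: "block n A i j = sol_A n d s P X Y i j"
      and bB: "block n B i j = sol_B n d s P X Y i j"
      if "i \<in> {1..s + 1}" "j \<in> {1..s + 1}" for i j
      unfolding A_def B_def using that
      by (auto intro!: block_from_blocks sol_A_carrier sol_B_carrier assms(1) X Y)
    \<comment> \<open>Above the diagonal A carries the blocks X, so sums over its own blocks agree
      with those over the parameters.\<close>
    have offA: "offdiag_sum n (s + 1) (block n A) t = offdiag_sum n (s + 1) X t" for t
      by (intro offdiag_sum_cong X) (auto simp: bA sol_A_def)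
    have offB: "offdiag_sum n (s + 1) (block n B) t = offdiag_sum n (s + 1) Y t" for t
      by (intro offdiag_sum_cong Y) (auto simp: bB sol_B_def)
    \<comment> \<open>After this exchange the criterion for the diagonal blocks is the very formula
      by which they were built.\<close>
    have "satisfies_system n d s P A B"
      unfolding satisfies_system_iff[OF assms(1) A B d] sol_A_diag sol_B_diag offA offB
      by (intro ballI conjI trans[OF bA sol_A_diag] trans[OF bB sol_B_diag])
    then show "L \<in> {pencil A B | A B.
            A \<in> carrier_mat ((s + 1) * n) ((s + 1) * n) \<and>
            B \<in> carrier_mat ((s + 1) * n) ((s + 1) * n) \<and>
            transpose_mat A = A \<and> transpose_mat B = B \<and>
            satisfies_system n d s P A B}"
      using A B unfolding L A_def[symmetric] B_def[symmetric] by blast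
  qed
qed

end
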